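(* Let $\mathcal{Q}$ be a finite classical polar space of rank $r\ge 1$ and type $Q$ over $\mathbb{F}_q$, and let $D$ be a $t$-$(r,k,\lambda)_Q$ design in $\mathcal{Q}$. Then the supplementary design $D^{\complement}$, consisting of all $k$-dimensional subspaces of $\mathcal{Q}$ that are not in $D$, is a $t$-$\left(r,k,\begin{bmatrix} r-t\\ k-t\end{bmatrix}_Q-\lambda\right)_Q$ design in $\mathcal{Q}$.
   Context: Let $q$ be a prime power. A finite classical polar space $\mathcal{Q}$ over $\mathbb{F}_q$ consists of all subspaces of a finite-dimensional $\mathbb{F}_q$-vector space $V$, $n=\dim V$, that are totally isotropic (resp. totally singular) with respect to a non-degenerate alternating or Hermitian form (resp. a non-singular quadratic form) on $V$. All dimensions are vector space dimensions. The rank $r$ is the maximal dimension of a subspace in $\mathcal{Q}$. The type $Q$ of $\mathcal{Q}$ (kind of form together with $q$) and its parameter $\epsilon$ are: symplectic $\mathrm{Sp}(q)$ ($n=2r$, $\epsilon=0$); Hermitian $U^+(q)$ ($q$ a square, $n=2r$, $\epsilon=-1/2$); Hermitian $U^-(q)$ ($q$ a square, $n=2r+1$, $\epsilon=1/2$); hyperbolic $\Omega^+(q)$ ($n=2r$, $\epsilon=-1$); parabolic $\Omega(q)$ ($n=2r+1$, $\epsilon=0$); elliptic $\Omega^-(q)$ ($n=2r+2$, $\epsilon=1$). $\begin{bmatrix} m\\ k\end{bmatrix}_q$ is the Gaussian binomial coefficient (number of $k$-dimensional subspaces of $\mathbb{F}_q^m$, and $0$ if $k<0$ or $k>m$). $\begin{bmatrix}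 m\\ k\end{bmatrix}_Q=\begin{bmatrix} m\\ k\end{bmatrix}_q\prod_{i=m-k+1}^{m}(q^{i+\epsilon}+1)$ is the number of $k$-dimensional subspaces in a polar space of type $Q$ and rank $m$ (and $0$ if $k<0$ or $k>m$). For $t,k\in\{0,\ldots,r\}$ and an integer $\lambda\ge 0$, a $t$-$(r,k,\lambda)_Q$ design in $\mathcal{Q}$ is a set $D$ of $k$-dimensional subspaces of $\mathcal{Q}$ (called blocks) such that every $t$-dimensional subspace of $\mathcal{Q}$ is contained in exactly $\lambda$ elements of $D$. *)

theory Defs
  imports Complex_Main "HOL-Library.Cardinality" "HOL-Library.FuncSet"
begin

section \<open>Gaussian binomial coefficients\<close>

text \<open>
  Integer arguments, so that a lower argument such as \<open>k - t\<close> may be negative.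
\<close>

definition gauss_binomial :: "nat \<Rightarrow> int \<Rightarrow> int \<Rightarrow> real" where
  "gauss_binomial q m k =
     (if k < 0 \<or> k > m then 0
      else (\<Prod>i\<in>{1..k}. (real q powi (m - k + i) - 1) / (real q powi i - 1)))"

lemma card_span_independent:
  fixes scale :: "'a::{field,finite} \<Rightarrow> 'v::ab_group_add \<Rightarrow> 'v"
  assumes V: "vector_space scale" and B: "finite B" and ind: "\<not> module.dependent scale B"
  shows "card (module.span scale B) = CARD('a) ^ card B" "finite (module.span scale B)"
proof -
  interpret vector_space scale by fact
  let ?f = "\<lambda>u. \<Sum>v\<in>B. scale (u v) v"
  have img: "span B = ?f ` (B \<rightarrow>\<^sub>E UNIV)"
  proof (rule subset_antisym)
    show "span B \<subseteq> ?f ` (B \<rightarrow>\<^sub>E UNIV)"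
    proof
      fix x assume "x \<in> span B"
      then obtain u where u: "x = ?f u" using span_finite[OF B] by auto
      have "x = ?f (restrict u B)" unfolding u by (rule sum.cong) auto
      then show "x \<in> ?f ` (B \<rightarrow>\<^sub>E UNIV)" by (intro image_eqI[where x="restrict u B"]) simp_all
    qed
    show "?f ` (B \<rightarrow>\<^sub>E UNIV) \<subseteq> span B" using span_finite[OF B] by auto
  qed
  have inj: "inj_on ?f (B \<rightarrow>\<^sub>E UNIV)"
  proof (rule inj_onI)
    fix u w assume u: "u \<in> B \<rightarrow>\<^sub>E UNIV" and w: "w \<in> B \<rightarrow>\<^sub>E UNIV" and eq: "?f u = ?f w"
    have z: "(\<Sum>v\<in>B. scale (u v - w v) v) = 0"
      using eq by (simp add: scale_left_diff_distrib sum_subtractf)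
    have i: "(\<Sum>v\<in>B. scale (g v) v) = 0 \<Longrightarrow> \<forall>v\<in>B. g v = 0" for g
      using ind unfolding dependent_finite[OF B] by blast
    have "\<forall>v\<in>B. u v - w v = 0" by (rule i[of "\<lambda>v. u v - w v", OF z])
    then show "u = w" using u w by (intro PiE_ext[OF u w]) auto
  qed
  show "card (span B) = CARD('a) ^ card B"
    unfolding img card_image[OF inj] using B by (simp add: card_funcsetE)
  show "finite (span B)" unfolding img using B by (intro finite_imageI finite_PiE) auto
qed

context vector_space begin
definition indep_lists :: "'b set \<Rightarrow> nat \<Rightarrow> 'b list set" where
  "indep_lists S k = {xs. length xs = k \<and> distinct xs \<and> independent (set xs) \<and> set xs \<subseteq> S}"
end

lemma card_indep_lists:
  fixes scale :: "'a::{field,finite} \<Rightarrow> 'v::ab_group_add \<Rightarrow> 'v"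
  assumes V: "finite_dimensional_vector_space scale Basis" and S: "module.subspace scale S"
  shows "k \<le> vector_space.dim scale S \<Longrightarrow>
    finite (vector_space.indep_lists scale S k) \<and>
    real (card (vector_space.indep_lists scale S k)) =
      (\<Prod>i<k. real CARD('a) ^ vector_space.dim scale S - real CARD('a) ^ i)"
proof (induction k)
  interpret finite_dimensional_vector_space scale Basis by fact
  case 0
  have "indep_lists S 0 = {[]}" by (auto simp: indep_lists_def independent_empty)
  then show ?case by simp
next
  interpret finite_dimensional_vector_space scale Basis by fact
  case (Suc k)
  let ?q = "CARD('a)" and ?d = "dim S"
  obtain B where B: "B \<subseteq> S" "independent B" "S \<subseteq> span B" "card B = dim S"
    using basis_exists by blast
  have SB: "S = span B" using B S by (metis span_minimal subset_antisym)
  have cS: "card S = ?q ^ ?d" and fS: "finite S"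
    using card_span_independent[OF vector_space_axioms finiteI_independent[OF B(2)] B(2)] SB B by auto
  have L: "indep_lists S (Suc k) = (\<lambda>(xs, x). x # xs) ` Sigma (indep_lists S k) (\<lambda>xs. S - span (set xs))"
    (is "?A = ?B")
  proof (rule subset_antisym)
    show "?B \<subseteq> ?A"
      by (auto simp: indep_lists_def intro: span_base dest: dependent_insertD)
    show "?A \<subseteq> ?B"
    proof
      fix ys assume "ys \<in> ?A"
      then obtain x xs where ys: "ys = x # xs" "length xs = k" "distinct xs" "x \<notin> set xs"
         "independent (insert x (set xs))" "x \<in> S" "set xs \<subseteq> S"
        by (cases ys) (auto simp: indep_lists_def)
      have "x \<notin> span (set xs) \<and> independent (set xs)"
        using ys independent_insert by metis
      then have "(xs, x) \<in> Sigma (indep_lists S k) (\<lambda>xs. S - span (set xs))"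
        using ys by (auto simp: indep_lists_def)
      then show "ys \<in> ?B" unfolding ys by (rule rev_image_eqI) simp
    qed
  qed
  have inj: "inj_on (\<lambda>(xs, x). x # xs) X" for X :: "('v list \<times> 'v) set" by (auto simp: inj_on_def)
  have fin: "finite (indep_lists S k)" using Suc by auto
  have each: "real (card (S - span (set xs))) = real ?q ^ ?d - real ?q ^ k" if "xs \<in> indep_lists S k" for xs
  proof -
    have xs: "independent (set xs)" "card (set xs) = k" "set xs \<subseteq> S"
      using that by (auto simp: indep_lists_def distinct_card)
    note c = card_span_independent[OF vector_space_axioms finite_set xs(1)]
    have sub: "span (set xs) \<subseteq> S" using xs S span_minimal by blast
    show ?thesis using card_Diff_subset[OF c(2) sub] card_mono[OF fS sub] c(1) cS xs
      by (simp add: of_nat_diff)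
  qed
  have "real (card (indep_lists S (Suc k))) = (\<Sum>xs\<in>indep_lists S k. real (card (S - span (set xs))))"
    unfolding L card_image[OF inj] using fin fS by (simp add: card_SigmaI)
  also have "\<dots> = (\<Prod>i<Suc k. real ?q ^ ?d - real ?q ^ i)" using each Suc by simp
  finally show ?case unfolding L using fin fS by auto
qed

text \<open>The Gaussian binomial coefficient counts the subspaces of a given dimension.\<close>

lemma card_subspaces_eq_gauss_binomial:
  fixes scale :: "'a::{field,finite} \<Rightarrow> 'v::ab_group_add \<Rightarrow> 'v"
  assumes V: "finite_dimensional_vector_space scale Basis"
  shows "real (card {U. module.subspace scale U \<and> vector_space.dim scale U = k}) =
           gauss_binomial CARD('a) (int (vector_space.dim scale UNIV)) (int k)"
proof -
  interpret finite_dimensional_vector_space scale Basis by fact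
  let ?q = "real CARD('a)" and ?n = "dim UNIV" and ?G = "{U. subspace U \<and> dim U = k}"
  have "card {0::'a, 1} \<le> CARD('a)" by (intro card_mono) auto
  then have q: "?q > 1" by simp
  show ?thesis
  proof (cases "k \<le> ?n")
    case False
    have "?G = {}" using False dim_subset[of _ UNIV] by (auto simp del: dim_UNIV)
    then have "card ?G = 0" by (simp only: card.empty)
    then show ?thesis using False by (simp add: gauss_binomial_def del: dim_UNIV)
  next
    case True
    have un: "indep_lists UNIV k = (\<Union>U\<in>?G. indep_lists U k)"
    proof (intro subset_antisym subsetI)
      fix xs assume xs: "xs \<in> indep_lists UNIV k"
      then have "xs \<in> indep_lists (span (set xs)) k" "dim (span (set xs)) = k"
        by (auto simp: indep_lists_def span_base dim_span_eq_card_independent distinct_card simp del: dim_span)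
      then show "xs \<in> (\<Union>U\<in>?G. indep_lists U k)" by (intro UN_I[of "span (set xs)"]) auto
    qed (auto simp: indep_lists_def)
    have dj: "U = W" if "U \<in> ?G" "W \<in> ?G" "xs \<in> indep_lists U k" "xs \<in> indep_lists W k" for U W xs
    proof -
      have *: "X = span (set xs)" if "X \<in> ?G" "xs \<in> indep_lists X k" for X
        using that card_eq_dim[of "set xs" X] span_minimal[of "set xs" X]
        by (auto simp: indep_lists_def distinct_card)
      show ?thesis using * that by metis
    qed
    have fU: "finite (UNIV :: 'v set)"
      using card_span_independent(2)[OF vector_space_axioms finite_Basis independent_Basis] span_Basis by simp
    have "card (indep_lists UNIV k) = (\<Sum>U\<in>?G. card (indep_lists U k))"
      unfolding un
    proof (rule card_UN_disjoint)
      show "finite ?G" using fU by (metis finite_subset[OF subset_UNIV] finite_Pow_iff Pow_UNIV)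
      show "\<forall>U\<in>?G. finite (indep_lists U k)" using card_indep_lists[OF V, of _ k] by simp
      show "\<forall>U\<in>?G. \<forall>W\<in>?G. U \<noteq> W \<longrightarrow> indep_lists U k \<inter> indep_lists W k = {}"
      proof (intro ballI impI)
        fix U W assume UW: "U \<in> ?G" "W \<in> ?G" "U \<noteq> W"
        show "indep_lists U k \<inter> indep_lists W k = {}"
          using dj[OF UW(1,2)] UW(3) by blast
      qed
    qed
    then have "real (card (indep_lists UNIV k)) = (\<Sum>U\<in>?G. real (card (indep_lists U k)))" by simp
    also have "\<dots> = real (card ?G) * (\<Prod>i<k. ?q ^ k - ?q ^ i)"
      using card_indep_lists[OF V, of _ k] by simp
    finally have eq: "(\<Prod>i<k. ?q ^ ?n - ?q ^ i) = real (card ?G) * (\<Prod>i<k. ?q ^ k - ?q ^ i)"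
      using card_indep_lists[OF V subspace_UNIV True] by simp
    have nz: "?q ^ k - ?q ^ i \<noteq> 0" if "i < k" for i using that q by simp
    have "(\<Prod>i\<in>{1..int k}. (?q powi (int ?n - int k + i) - 1) / (?q powi i - 1)) =
          (\<Prod>i<k. (?q ^ ?n - ?q ^ i) / (?q ^ k - ?q ^ i))"
    proof (rule prod.reindex_bij_witness[where i = "\<lambda>i. int k - int i" and j = "\<lambda>i. k - nat i"])
      fix a assume a: "a \<in> {1..int k}"
      define i where "i = k - nat a"
      have ai: "a = int (k - i)" "i < k" using a by (auto simp: i_def)
      have "?q ^ ?n - ?q ^ i = ?q ^ i * (?q ^ (?n - i) - 1)"
           "?q ^ k - ?q ^ i = ?q ^ i * (?q ^ (k - i) - 1)"
        using ai True by (simp_all add: right_diff_distrib flip: power_add)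
      moreover have "int ?n - int k + a = int (?n - i)" using ai True by linarith
      ultimately show "(?q ^ ?n - ?q ^ (k - nat a)) / (?q ^ k - ?q ^ (k - nat a)) =
         (?q powi (int ?n - int k + a) - 1) / (?q powi a - 1)"
        using q unfolding i_def[symmetric] by (simp add: ai(1) power_int_of_nat del: dim_UNIV of_nat_diff)
    qed auto
    also have "\<dots> = real (card ?G)" using eq nz by (simp add: prod_dividef)
    finally show ?thesis using True by (simp add: gauss_binomial_def del: dim_UNIV)
  qed
qed


section \<open>Types of polar spaces\<close>

datatype polar_type =
    Symplectic | Hermitian_Plus | Hermitian_Minus | Hyperbolic | Parabolic | Elliptic

fun polar_eps :: "polar_type \<Rightarrow> real" where
  "polar_eps Symplectic = 0"
| "polar_eps Hermitian_Plus = - 1 / 2"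
| "polar_eps Hermitian_Minus = 1 / 2"
| "polar_eps Hyperbolic = - 1"
| "polar_eps Parabolic = 0"
| "polar_eps Elliptic = 1"

definition polar_binomial :: "polar_type \<Rightarrow> nat \<Rightarrow> int \<Rightarrow> int \<Rightarrow> real" where
  "polar_binomial Q q m k =
     (if k < 0 \<or> k > m then 0
      else gauss_binomial q m k
             * (\<Prod>i\<in>{m - k + 1..m}. real q powr (real_of_int i + polar_eps Q) + 1))"


section \<open>Forms\<close>

definition bilinear_form ::
    "('a::field \<Rightarrow> 'v::ab_group_add \<Rightarrow> 'v) \<Rightarrow> ('v \<Rightarrow> 'v \<Rightarrow> 'a) \<Rightarrow> bool" where
  "bilinear_form scale B \<longleftrightarrow>
     (\<forall>y. Vector_Spaces.linear scale (*) (\<lambda>x. B x y)) \<and>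
     (\<forall>x. Vector_Spaces.linear scale (*) (\<lambda>y. B x y))"

definition nondegenerate :: "('v::ab_group_add \<Rightarrow> 'v \<Rightarrow> 'a::field) \<Rightarrow> bool" where
  "nondegenerate B \<longleftrightarrow> (\<forall>x. (\<forall>y. B x y = 0) \<longrightarrow> x = 0)"

definition alternating_form ::
    "('a::field \<Rightarrow> 'v::ab_group_add \<Rightarrow> 'v) \<Rightarrow> ('v \<Rightarrow> 'v \<Rightarrow> 'a) \<Rightarrow> bool" where
  "alternating_form scale B \<longleftrightarrow> bilinear_form scale B \<and> (\<forall>x. B x x = 0)"

text \<open>
  A finite field has an involutory automorphism only if its order is a square \<open>s\<^sup>2\<close>, and then
  the automorphism is \<open>c \<mapsto> c ^ s\<close>.
\<close>

definition hermitian_form ::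
    "('a::{field,finite} \<Rightarrow> 'v::ab_group_add \<Rightarrow> 'v) \<Rightarrow> ('v \<Rightarrow> 'v \<Rightarrow> 'a) \<Rightarrow> bool" where
  "hermitian_form scale B \<longleftrightarrow>
     (\<exists>s. CARD('a) = s\<^sup>2 \<and>
        (\<forall>y. Vector_Spaces.linear scale (*) (\<lambda>x. B x y)) \<and>
        (\<forall>x y z. B x (y + z) = B x y + B x z) \<and>
        (\<forall>c x y. B x (scale c y) = c ^ s * B x y) \<and>
        (\<forall>x y. B y x = (B x y) ^ s))"

definition polarization :: "('v::ab_group_add \<Rightarrow> 'a::field) \<Rightarrow> 'v \<Rightarrow> 'v \<Rightarrow> 'a" where
  "polarization f x y = f (x + y) - f x - f y"

definition quadratic_form ::
    "('a::field \<Rightarrow> 'v::ab_group_add \<Rightarrow> 'v) \<Rightarrow> ('v \<Rightarrow> 'a) \<Rightarrow> bool" where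
  "quadratic_form scale f \<longleftrightarrow>
     (\<forall>c x. f (scale c x) = c\<^sup>2 * f x) \<and> bilinear_form scale (polarization f)"

text \<open>
  In characteristic 2 and odd dimension the polarization always has a nonzero radical, so a
  non-singular quadratic form is only required to have no nonzero singular vector there.
\<close>

definition nonsingular :: "('v::ab_group_add \<Rightarrow> 'a::field) \<Rightarrow> bool" where
  "nonsingular f \<longleftrightarrow> (\<forall>x. f x = 0 \<and> (\<forall>y. polarization f x y = 0) \<longrightarrow> x = 0)"


section \<open>Finite classical polar spaces\<close>

datatype ('a, 'v) polar_form =
    Alternating "'v \<Rightarrow> 'v \<Rightarrow> 'a"
  | Hermitian "'v \<Rightarrow> 'v \<Rightarrow> 'a"
  | Quadratic "'v \<Rightarrow> 'a"

fun admissible_form ::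
    "('a::{field,finite} \<Rightarrow> 'v::ab_group_add \<Rightarrow> 'v) \<Rightarrow> ('a, 'v) polar_form \<Rightarrow> bool" where
  "admissible_form scale (Alternating B) \<longleftrightarrow> alternating_form scale B \<and> nondegenerate B"
| "admissible_form scale (Hermitian B) \<longleftrightarrow> hermitian_form scale B \<and> nondegenerate B"
| "admissible_form scale (Quadratic f) \<longleftrightarrow> quadratic_form scale f \<and> nonsingular f"

fun vanishes_on :: "('a::field, 'v::ab_group_add) polar_form \<Rightarrow> 'v set \<Rightarrow> bool" where
  "vanishes_on (Alternating B) U \<longleftrightarrow> (\<forall>x\<in>U. \<forall>y\<in>U. B x y = 0)"
| "vanishes_on (Hermitian B) U \<longleftrightarrow> (\<forall>x\<in>U. \<forall>y\<in>U. B x y = 0)"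
| "vanishes_on (Quadratic f) U \<longleftrightarrow> (\<forall>x\<in>U. f x = 0)"

definition polar_space ::
    "('a::field \<Rightarrow> 'v::ab_group_add \<Rightarrow> 'v) \<Rightarrow> ('a, 'v) polar_form \<Rightarrow> 'v set set" where
  "polar_space scale F = {U. module.subspace scale U \<and> vanishes_on F U}"

definition polar_subspaces ::
    "('a::field \<Rightarrow> 'v::ab_group_add \<Rightarrow> 'v) \<Rightarrow> ('a, 'v) polar_form \<Rightarrow> nat \<Rightarrow> 'v set set" where
  "polar_subspaces scale F k = {U \<in> polar_space scale F. vector_space.dim scale U = k}"

definition polar_rank ::
    "('a::field \<Rightarrow> 'v::ab_group_add \<Rightarrow> 'v) \<Rightarrow> ('a, 'v) polar_form \<Rightarrow> nat" where
  "polar_rank scale F = Max (vector_space.dim scale ` polar_space scale F)"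

text \<open>\<open>form_type F n r Q\<close>: the type \<open>Q\<close> of a form on an \<open>n\<close>-dimensional space with rank \<open>r\<close>.\<close>

fun form_type :: "('a, 'v) polar_form \<Rightarrow> nat \<Rightarrow> nat \<Rightarrow> polar_type \<Rightarrow> bool" where
  "form_type (Alternating B) n r Q \<longleftrightarrow> Q = Symplectic \<and> n = 2 * r"
| "form_type (Hermitian B) n r Q \<longleftrightarrow>
     Q = Hermitian_Plus \<and> n = 2 * r \<or> Q = Hermitian_Minus \<and> n = 2 * r + 1"
| "form_type (Quadratic f) n r Q \<longleftrightarrow>
     Q = Hyperbolic \<and> n = 2 * r \<or> Q = Parabolic \<and> n = 2 * r + 1 \<or>
     Q = Elliptic \<and> n = 2 * r + 2"

locale classical_polar_space = finite_dimensional_vector_space scale Basis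
  for scale :: "'a::{field,finite} \<Rightarrow> 'v::ab_group_add \<Rightarrow> 'v" and Basis :: "'v set" +
  fixes F :: "('a, 'v) polar_form" and Q :: polar_type and r :: nat
  assumes admissible: "admissible_form scale F"
    and rank: "polar_rank scale F = r"
    and has_type: "form_type F (dim UNIV) r Q"


section \<open>Designs in polar spaces\<close>

text \<open>
  The index \<open>l\<close> is a real number, so that differences with \<^const>\<open>polar_binomial\<close> do not truncate;
  being a nonnegative integer is part of being a design.
\<close>

definition polar_design ::
    "('a::field \<Rightarrow> 'v::ab_group_add \<Rightarrow> 'v) \<Rightarrow> ('a, 'v) polar_form \<Rightarrow>
      nat \<Rightarrow> nat \<Rightarrow> real \<Rightarrow> 'v set set \<Rightarrow> bool" where
  "polar_design scale F t k l D \<longleftrightarrow>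
     t \<le> polar_rank scale F \<and> k \<le> polar_rank scale F \<and> l \<in> \<nat> \<and>
     D \<subseteq> polar_subspaces scale F k \<and>
     (\<forall>T \<in> polar_subspaces scale F t. real (card {B \<in> D. T \<subseteq> B}) = l)"

definition supplementary_design ::
    "('a::field \<Rightarrow> 'v::ab_group_add \<Rightarrow> 'v) \<Rightarrow> ('a, 'v) polar_form \<Rightarrow>
      nat \<Rightarrow> 'v set set \<Rightarrow> 'v set set" where
  "supplementary_design scale F k D = {B \<in> polar_subspaces scale F k. B \<notin> D}"

end

theory Submission
  imports Defs "HOL-Computational_Algebra.Polynomial"
begin

text \<open>
  Everything rests on the fact that the number of blocks of dimension \<open>k\<close> through a totally isotropic
  \<open>T\<close> depends only on \<open>dim T\<close>. Let \<open>z T\<close> be the number of isotropic vectors in the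
  perp of \<open>T\<close>. If \<open>x\<close> is isotropic and \<open>v\<close> is not orthogonal to \<open>x\<close>, then the line
  \<open>v + \<langle>x\<rangle>\<close> contains a number \<open>N\<close> of isotropic vectors that depends only on the kind of form. Hence
  \<open>q * z T - N * |perp T|\<close> is unchanged when \<open>T\<close> is enlarged by an isotropic vector of its perp, so it
  takes the same value at \<open>{0}\<close>, at \<open>T\<close> and at a totally isotropic \<open>M\<close> of maximal dimension \<open>r\<close>, where
  \<open>z M = q ^ r\<close>. This determines \<open>z T\<close> without Witt's theorem, and double counting the pairs \<open>(v, K)\<close>
  with \<open>v \<in> K - T\<close> gives the number of extensions \<open>K\<close> of \<open>T\<close> by induction on \<open>k - dim T\<close>.
\<close>

section \<open>Recurrence for the polar Gaussian coefficients\<close>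

lemma polar_binomial_0: "0 \<le> m \<Longrightarrow> polar_binomial Q q m 0 = 1"
  by (simp add: polar_binomial_def gauss_binomial_def)

text \<open>The factor at \<open>i = k\<close> of the first product and at \<open>i = m\<close> of
  the second split off; the others agree because \<open>m - k\<close> is unchanged.\<close>

lemma polar_binomial_rec:
  assumes "q > 1" "1 \<le> k" "k \<le> m"
  shows "polar_binomial Q q m k * (real q powi k - 1) =
    (real q powi m - 1) * (real q powr (of_int m + polar_eps Q) + 1) * polar_binomial Q q (m - 1) (k - 1)"
proof -
  have "{1..k} = insert k {1..k - 1}" "{m - k + 1..m} = insert m {m - k + 1..m - 1}"
    using assms by auto
  moreover have "real q powi k \<noteq> 1"
  proof -
    have "real q ^ nat k > 1" using assms by (intro one_less_power) auto
    then show ?thesis using assms(2) by (simp add: power_int_def del: One_nat_def)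
  qed
  ultimately show ?thesis
    using assms by (simp add: polar_binomial_def gauss_binomial_def)
qed

section \<open>Trace fibres in a field of square order\<close>

text \<open>
  Each of the at most \<open>s\<close> fibres of the trace has at most \<open>s\<close> elements, and together they have
  \<open>s\<^sup>2\<close> elements, so both bounds are attained.
\<close>

lemma card_trace_fibre:
  fixes e :: "'a::{field,finite}"
  assumes s: "CARD('a) = s\<^sup>2"
    and add: "\<And>a b :: 'a. (a + b) ^ s = a ^ s + b ^ s"
    and invol: "\<And>a :: 'a. (a ^ s) ^ s = a"
    and e: "e ^ s = e"
  shows "card {d. d + d ^ s = e} = s"
proof -
  have "card {0::'a, 1} \<le> CARD('a)" by (intro card_mono) auto
  then have s2: "s \<ge> 2" using s by (cases "s = 0 \<or> s = 1") auto
  \<comment> \<open>\<open>a = 1\<close> yields the trace fibres, \<open>a = - 1\<close> with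
    \<open>c = 0\<close> the fixed elements \<open>?E\<close>. As \<open>s \<ge> 2\<close>, the
    polynomial has leading coefficient 1 in degree \<open>s\<close>.\<close>
  have bound: "card {d::'a. d ^ s + a * d = c} \<le> s" for a c
  proof -
    let ?p = "monom 1 s + monom a 1 - [:c:]"
    have "poly.coeff ?p s = 1" using s2 by (auto simp: coeff_pCons split: nat.split)
    then have "?p \<noteq> 0" by (metis coeff_0 zero_neq_one)
    moreover have "degree ?p \<le> s"
      using s2 by (intro degree_diff_le degree_add_le degree_monom_le[THEN order_trans]) auto
    ultimately have "card {x. poly ?p x = 0} \<le> s"
      using card_poly_roots_bound order_trans by blast
    then show ?thesis by (simp add: poly_monom)
  qed
  let ?E = "{e::'a. e ^ s = e}" and ?fib = "\<lambda>e::'a. {d. d + d ^ s = e}"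
  have fib: "card (?fib a) \<le> s" for a using bound[of 1 a] by (simp add: add.commute)
  have E: "card ?E \<le> s" using bound[of "-1" 0] by simp
  \<comment> \<open>By \<open>add\<close> and \<open>invol\<close> each \<open>d + d ^ s\<close> is
    fixed by the power \<open>s\<close>, so the fibres over \<open>?E\<close> cover the
    field.\<close>
  have un: "UNIV = (\<Union>a\<in>?E. ?fib a)" by (auto simp: add invol add.commute)
  have "s\<^sup>2 = card (\<Union>a\<in>?E. ?fib a)" using s un by simp
  also have "\<dots> = (\<Sum>a\<in>?E. card (?fib a))" by (intro card_UN_disjoint) auto
  also have "\<dots> = card (?fib e) + (\<Sum>a\<in>?E - {e}. card (?fib a))"
    using e by (intro sum.remove) auto
  also have "(\<Sum>a\<in>?E - {e}. card (?fib a)) \<le> card (?E - {e}) * s"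
    using sum_bounded_above[of "?E - {e}" "\<lambda>a. card (?fib a)" s] fib by simp
  also have "\<dots> \<le> (s - 1) * s" using E e by (intro mult_right_mono) auto
  finally have "s\<^sup>2 \<le> card (?fib e) + (s - 1) * s" by simp
  moreover have "s\<^sup>2 = s + (s - 1) * s" using s2 by (cases s) (auto simp: power2_eq_square)
  ultimately show ?thesis using fib[of e] by linarith
qed

lemma card_scale_preimage:
  fixes a :: "'a::field"
  assumes "a \<noteq> 0"
  shows "card {c. P (c * a)} = card {d. P d}"
proof (rule bij_betw_same_card)
  show "bij_betw (\<lambda>c. c * a) {c. P (c * a)} {d. P d}"
    using assms by (intro bij_betw_byWitness[where f' = "\<lambda>d. d / a"]) auto
qed

section \<open>Isotropic vectors of an abstract reflexive form\<close>

text \<open>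
  \<open>N\<close> is \<open>q\<close> for alternating forms, the square root of \<open>q\<close> for Hermitian forms, and 1 for quadratic forms.
  The form may have a radical (a quadratic form in characteristic 2), but no nonzero isotropic
  vector lies in it.
\<close>

locale isotropy = finite_dimensional_vector_space scale Basis
  for scale :: "'a::{field,finite} \<Rightarrow> 'v::ab_group_add \<Rightarrow> 'v" and Basis :: "'v set" +
  fixes iso :: "'v \<Rightarrow> bool" and \<beta> :: "'v \<Rightarrow> 'v \<Rightarrow> 'a" and N :: nat
  assumes form_add: "\<beta> (x + y) z = \<beta> x z + \<beta> y z"
    and form_scale: "\<beta> (scale c x) z = c * \<beta> x z"
    and form_refl: "\<beta> x y = 0 \<Longrightarrow> \<beta> y x = 0"
    and form_radical: "iso x \<Longrightarrow> (\<And>y. \<beta> y x = 0) \<Longrightarrow> x = 0"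
    and form_self: "iso x \<Longrightarrow> \<beta> x x = 0"
    and iso_zero: "iso 0"
    and iso_line: "iso u \<Longrightarrow> iso v \<Longrightarrow> \<beta> u v = 0 \<Longrightarrow> iso (u + scale c v)"
    and card_iso_line: "iso x \<Longrightarrow> \<beta> v x \<noteq> 0 \<Longrightarrow> card {c. iso (v + scale c x)} = N"
begin

definition tiso :: "'v set \<Rightarrow> bool" where
  "tiso U \<longleftrightarrow> subspace U \<and> (\<forall>x\<in>U. iso x) \<and> (\<forall>x\<in>U. \<forall>y\<in>U. \<beta> x y = 0)"

text \<open>The free vector stands in the first argument, the one in which \<open>\<beta>\<close> is
  assumed linear.\<close>

definition perp :: "'v set \<Rightarrow> 'v set" where
  "perp T = {v. \<forall>x\<in>T. \<beta> v x = 0}"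

definition isoperp :: "'v set \<Rightarrow> 'v set" where
  "isoperp T = {v \<in> perp T. iso v}"

lemma q_gt_1: "CARD('a) > 1"
proof -
  have "card {0::'a, 1} \<le> CARD('a)" by (intro card_mono) auto
  then show ?thesis by simp
qed

lemma form_0 [simp]: "\<beta> 0 z = 0" "\<beta> z 0 = 0"
  using form_scale[of 0 0 z] form_refl[of 0 z] by auto

lemma form_minus: "\<beta> (- x) z = - \<beta> x z"
  using form_add[of x "- x" z] by (simp add: eq_neg_iff_add_eq_0 add.commute)

lemma form_diff: "\<beta> (x - y) z = \<beta> x z - \<beta> y z"
  using form_add[of x "- y" z] by (simp add: form_minus)

lemma form_comm_0: "\<beta> x y = 0 \<longleftrightarrow> \<beta> y x = 0"
  using form_refl by blast

lemma finite_UNIV_space: "finite (UNIV :: 'v set)"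
  using card_span_independent(2)[OF vector_space_axioms finite_Basis independent_Basis] span_Basis by simp

lemma finite_space [simp]: "finite (S :: 'v set)"
  by (rule finite_subset[OF subset_UNIV finite_UNIV_space])

lemma finite_space_set [simp]: "finite (\<S> :: 'v set set)"
proof (rule finite_subset)
  show "\<S> \<subseteq> Pow UNIV" by simp
  show "finite (Pow (UNIV :: 'v set))" using finite_UNIV_space by (simp only: finite_Pow_iff)
qed

section \<open>Sizes of subspaces and perps\<close>

lemma card_subspace:
  assumes "subspace S"
  shows "card S = CARD('a) ^ dim S"
proof -
  obtain B where B: "B \<subseteq> S" "independent B" "S \<subseteq> span B" "card B = dim S"
    using basis_exists by blast
  have "S = span B" using B assms by (metis span_minimal subset_antisym)
  then show ?thesis
    using card_span_independent(1)[OF vector_space_axioms finiteI_independent[OF B(2)] B(2)] B by simp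
qed

text \<open>Splitting off the multiple \<open>f x / f y\<close> of \<open>y\<close> identifies
  \<open>S\<close> with the kernel times the field.\<close>

lemma card_kernel:
  assumes S: "subspace S" and y: "y \<in> S" "f y \<noteq> 0"
    and add: "\<And>x y. f (x + y) = f x + f y" and sc: "\<And>c x. f (scale c x) = c * f x"
  shows "card S = CARD('a) * card {x \<in> S. f x = (0::'a)}"
proof -
  let ?K = "{x \<in> S. f x = 0}"
  have diff: "f (a - b) = f a - f b" for a b
    using add[of "a - b" b] by simp
  have "bij_betw (\<lambda>(x, c). x + scale c y) (?K \<times> (UNIV::'a set)) S"
    by (rule bij_betw_byWitness[where f' = "\<lambda>x. (x - scale (f x / f y) y, f x / f y)"])
       (use S y in \<open>auto simp: add sc diff intro: subspace_add subspace_diff subspace_scale\<close>)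
  from bij_betw_same_card[OF this] show ?thesis by (simp add: card_cartesian_product mult.commute)
qed

text \<open>
  Double count the orthogonal pairs in \<open>V \<times> T\<close>; this avoids dual spaces and works for a degenerate form.
\<close>

lemma card_perp:
  assumes "tiso T"
  shows "card (perp T) * CARD('a) ^ dim T = CARD('a) ^ dim (UNIV :: 'v set)"
proof -
  let ?n = "dim (UNIV :: 'v set)" and ?t = "dim T"
  have T: "subspace T" "\<And>x. x \<in> T \<Longrightarrow> iso x" using assms by (auto simp: tiso_def)
  have L: "CARD('a) * card {x \<in> T. \<beta> v x = 0} = (if v \<in> perp T then CARD('a) * CARD('a) ^ ?t else CARD('a) ^ ?t)" for v
  proof (cases "v \<in> perp T")
    case True
    then have "{x \<in> T. \<beta> v x = 0} = T" by (auto simp: perp_def)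
    then show ?thesis using True T card_subspace by simp
  next
    case False
    then obtain y where "y \<in> T" "\<beta> y v \<noteq> 0" by (auto simp: perp_def form_comm_0)
    from card_kernel[OF T(1) this form_add form_scale] show ?thesis
      using False T card_subspace by (simp add: form_comm_0[of _ v])
  qed
  \<comment> \<open>A nonzero \<open>x\<close> in \<open>T\<close> is isotropic, hence outside the
    radical, so its functional is nonzero.\<close>
  have R: "CARD('a) * card {v. \<beta> v x = 0} = (if x = 0 then CARD('a) * CARD('a) ^ ?n else CARD('a) ^ ?n)" if "x \<in> T" for x
  proof (cases "x = 0")
    case True
    then show ?thesis using card_subspace[OF subspace_UNIV] by simp
  next
    case False
    then obtain y where "\<beta> y x \<noteq> 0" using form_radical T(2) \<open>x \<in> T\<close> by blast
    from card_kernel[OF subspace_UNIV UNIV_I, where f = "\<lambda>v. \<beta> v x", OF this form_add form_scale]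
    show ?thesis using False card_subspace[OF subspace_UNIV] by simp
  qed
  have "(\<Sum>v\<in>UNIV. CARD('a) * card {x \<in> T. \<beta> v x = 0}) = (\<Sum>x\<in>T. CARD('a) * card {v \<in> UNIV. \<beta> v x = 0})"
    using sum_multicount_gen[of UNIV T "\<lambda>v x. \<beta> v x = 0" "\<lambda>x. card {v. \<beta> v x = 0}"]
    by (simp flip: sum_distrib_left)
  then have "(\<Sum>v\<in>UNIV. if v \<in> perp T then CARD('a) * CARD('a) ^ ?t else CARD('a) ^ ?t) =
      (\<Sum>x\<in>T. if x = 0 then CARD('a) * CARD('a) ^ ?n else CARD('a) ^ ?n)"
    using L R by simp
  also have "(\<Sum>v\<in>UNIV. if v \<in> perp T then CARD('a) * CARD('a) ^ ?t else CARD('a) ^ ?t) =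
      card (perp T) * (CARD('a) * CARD('a) ^ ?t) + card (- perp T) * CARD('a) ^ ?t"
    by (subst sum.If_cases) auto
  also have "(\<Sum>x\<in>T. if x = 0 then CARD('a) * CARD('a) ^ ?n else CARD('a) ^ ?n) = CARD('a) * CARD('a) ^ ?n + card (T - {0}) * CARD('a) ^ ?n"
    using subspace_0[OF T(1)] by (subst sum.remove[of _ 0]) auto
  finally have eq: "card (perp T) * (CARD('a) * CARD('a) ^ ?t) + card (- perp T) * CARD('a) ^ ?t =
    CARD('a) * CARD('a) ^ ?n + card (T - {0}) * CARD('a) ^ ?n" .
  have "card (UNIV::'v set) = card (perp T \<union> - perp T)" by (simp only: Compl_partition)
  also have "\<dots> = card (perp T) + card (- perp T)" by (intro card_Un_disjoint) auto
  finally have "real CARD('a) ^ ?n = card (perp T) + card (- perp T)"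
    using card_subspace[OF subspace_UNIV] by (metis of_nat_add of_nat_power)
  then have a: "real (card (- perp T)) = real CARD('a) ^ ?n - card (perp T)" by simp
  have "card T = Suc (card (T - {0}))"
    using subspace_0[OF T(1)] by (intro card.remove) auto
  then have b: "real (card (T - {0})) = real CARD('a) ^ ?t - 1"
    using card_subspace[OF T(1)] by (metis add_diff_cancel_left' of_nat_Suc of_nat_power)
  have "real (card (perp T)) * (CARD('a) * CARD('a) ^ ?t) + (real CARD('a) ^ ?n - card (perp T)) * CARD('a) ^ ?t =
    CARD('a) * CARD('a) ^ ?n + (real CARD('a) ^ ?t - 1) * CARD('a) ^ ?n"
    using arg_cong[OF eq, of real] by (simp add: a b del: dim_UNIV)
  then have "(real CARD('a) - 1) * (card (perp T) * CARD('a) ^ ?t) = (real CARD('a) - 1) * CARD('a) ^ ?n"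
    by (simp add: algebra_simps del: dim_UNIV)
  then have "real (card (perp T) * CARD('a) ^ ?t) = real (CARD('a) ^ ?n)"
    using q_gt_1 by simp
  then show ?thesis by (simp only: of_nat_eq_iff)
qed

section \<open>Enlarging totally isotropic subspaces\<close>

lemma tiso_zero: "tiso {0}"
  by (simp add: tiso_def subspace_single_0 iso_zero)

lemma tiso_subset_isoperp: "tiso U \<Longrightarrow> T \<subseteq> U \<Longrightarrow> U \<subseteq> isoperp T"
  by (auto simp: tiso_def isoperp_def perp_def)

text \<open>Modulo a multiple of \<open>x\<close>, \<open>v\<close> lies in \<open>T\<close>.
  Together with \<open>form_refl\<close>, which swaps the arguments, this stands in for linearity in
  the second argument.\<close>

lemma form_insert:
  assumes "subspace T" "v \<in> span (insert x T)" "\<And>y. y \<in> T \<Longrightarrow> \<beta> y w = 0" "\<beta> x w = 0"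
  shows "\<beta> v w = 0"
proof -
  obtain c where c: "v - scale c x \<in> T"
    using assms(2) by (auto simp: span_breakdown_eq span_eq_iff[THEN iffD2, OF assms(1)])
  show ?thesis using assms(3)[OF c] assms(4) by (simp add: form_diff form_scale)
qed

lemma tiso_insert:
  assumes T: "tiso T" and x: "x \<in> isoperp T"
  shows "tiso (span (insert x T))"
proof -
  have sT: "subspace T" using T by (simp add: tiso_def)
  have x0: "\<beta> x y = 0" "\<beta> y x = 0" if "y \<in> T" for y
    using that x form_refl by (auto simp: isoperp_def perp_def)
  have xx: "iso x" "\<beta> x x = 0" using x form_self by (auto simp: isoperp_def)
  have "iso v" if "v \<in> span (insert x T)" for v
  proof -
    from that obtain c where c: "v - scale c x \<in> T"
      by (auto simp: span_breakdown_eq span_eq_iff[THEN iffD2, OF sT])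
    then have "iso ((v - scale c x) + scale c x)"
      using T x0 xx by (intro iso_line) (auto simp: tiso_def)
    then show ?thesis by simp
  qed
  moreover have "\<beta> v w = 0" if v: "v \<in> span (insert x T)" and w: "w \<in> span (insert x T)" for v w
  proof (rule form_insert[OF sT v])
    fix y assume "y \<in> T"
    then have "\<beta> w y = 0" using T x0 by (intro form_insert[OF sT w]) (auto simp: tiso_def)
    then show "\<beta> y w = 0" by (rule form_refl)
  next
    have "\<beta> w x = 0" using x0 xx by (intro form_insert[OF sT w])
    then show "\<beta> x w = 0" by (rule form_refl)
  qed
  ultimately show ?thesis by (simp add: tiso_def subspace_span)
qed

lemma dim_insert_new: "subspace T \<Longrightarrow> x \<notin> T \<Longrightarrow> dim (span (insert x T)) = Suc (dim T)"
  by (simp add: dim_insert span_eq_iff[THEN iffD2])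

lemma perp_insert:
  assumes "subspace T"
  shows "perp (span (insert x T)) = {v \<in> perp T. \<beta> v x = 0}"
proof (intro equalityI subsetI)
  fix v assume v: "v \<in> {v \<in> perp T. \<beta> v x = 0}"
  have "\<beta> v y = 0" if y: "y \<in> span (insert x T)" for y
  proof (rule form_refl, rule form_insert[OF assms y])
    show "\<beta> z v = 0" if "z \<in> T" for z
      using v that unfolding perp_def by (blast intro: form_refl)
    show "\<beta> x v = 0" using v by (blast intro: form_refl)
  qed
  then show "v \<in> perp (span (insert x T))" by (simp add: perp_def)
qed (auto simp: perp_def intro: span_base)

section \<open>Isotropic vectors in perps\<close>

text \<open>
  Off \<open>perp {x}\<close>, every affine line in the direction of the isotropic vector \<open>x\<close> contains exactly
  \<open>N\<close> isotropic vectors.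
\<close>

lemma card_isoperp_step:
  assumes T: "subspace T" and x: "x \<in> isoperp T"
  defines "T' \<equiv> span (insert x T)"
  shows "real CARD('a) * card (isoperp T) - real N * card (perp T) =
    real CARD('a) * card (isoperp T') - real N * card (perp T')"
proof -
  have ix: "iso x" "\<beta> x x = 0" and xT: "\<And>y. y \<in> T \<Longrightarrow> \<beta> x y = 0"
    using x form_self by (auto simp: isoperp_def perp_def)
  have P': "perp T' = {v \<in> perp T. \<beta> v x = 0}"
    unfolding T'_def by (rule perp_insert[OF T])
  let ?Y = "{v \<in> perp T. \<beta> v x \<noteq> 0}"
  \<comment> \<open>As \<open>x\<close> is orthogonal to itself and to \<open>T\<close>, translation
    along \<open>x\<close> changes neither \<open>\<beta> v x\<close> nor membership in
    \<open>perp T\<close>.\<close>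
  have shift: "v + scale c x \<in> ?Y \<longleftrightarrow> v \<in> ?Y" for v c
    using ix xT by (simp add: perp_def form_add form_scale)
  have k: "card {v \<in> ?Y. iso (v + scale c x)} = card {v \<in> ?Y. iso v}" for c
  proof (rule bij_betw_same_card)
    have sub: "v - scale c x \<in> ?Y \<longleftrightarrow> v \<in> ?Y" for v
      using shift[of v "- c"] by simp
    show "bij_betw (\<lambda>v. v + scale c x) {v \<in> ?Y. iso (v + scale c x)} {v \<in> ?Y. iso v}"
      using shift sub
      by (intro bij_betw_byWitness[where f' = "\<lambda>v. v - scale c x"]) auto
  qed
  \<comment> \<open>Count pairs \<open>(v, c)\<close> with \<open>v + c x\<close> isotropic: each
    \<open>v\<close> admits \<open>N\<close> scalars, each \<open>c\<close> a translate of the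
    isotropic part of \<open>?Y\<close>.\<close>
  have "(\<Sum>v\<in>?Y. card {c\<in>UNIV. iso (v + scale c x)}) = card {v \<in> ?Y. iso v} * CARD('a)"
    by (intro sum_multicount) (simp_all only: k finite finite_space ball_simps simp_thms)
  then have main: "N * card ?Y = CARD('a) * card {v \<in> ?Y. iso v}"
    using ix by (simp add: card_iso_line mult.commute)
  have "perp T = perp T' \<union> ?Y" unfolding P' by auto
  then have "card (perp T) = card (perp T') + card ?Y"
    using card_Un_disjoint[of "perp T'" ?Y] by (auto simp: P')
  moreover have "isoperp T = isoperp T' \<union> {v \<in> ?Y. iso v}" unfolding isoperp_def P' by auto
  then have "card (isoperp T) = card (isoperp T') + card {v \<in> ?Y. iso v}"
    using card_Un_disjoint[of "isoperp T'" "{v \<in> ?Y. iso v}"] by (auto simp: isoperp_def P')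
  moreover have "real N * card ?Y = real CARD('a) * card {v \<in> ?Y. iso v}"
    using arg_cong[OF main, of real] by (simp only: of_nat_mult)
  ultimately show ?thesis by (simp add: algebra_simps)
qed

text \<open>Vectors of \<open>U - T\<close> are added one at a time; each lies in
  \<open>isoperp\<close> of the current subspace because \<open>U\<close> is totally
  isotropic.\<close>

lemma card_isoperp_chain:
  assumes "tiso T" "tiso U" "T \<subseteq> U"
  shows "real CARD('a) * card (isoperp T) - real N * card (perp T) =
    real CARD('a) * card (isoperp U) - real N * card (perp U)"
  using assms
proof (induction "card (U - T)" arbitrary: T rule: less_induct)
  case less
  show ?case
  proof (cases "T = U")
    case False
    then obtain x where x: "x \<in> U" "x \<notin> T" using less.prems(3) by blast
    let ?T = "span (insert x T)"
    have xi: "x \<in> isoperp T" using tiso_subset_isoperp[OF less.prems(2,3)] x(1) by blast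
    have sT: "subspace T" and sU: "subspace U" using less.prems by (auto simp: tiso_def)
    have "?T \<subseteq> U" using x less.prems by (intro span_minimal sU) auto
    moreover have "card (U - ?T) < card (U - T)"
      using x span_superset[of "insert x T"] by (intro psubset_card_mono finite_space) blast
    ultimately have
      "real CARD('a) * card (isoperp ?T) - real N * card (perp ?T) =
        real CARD('a) * card (isoperp U) - real N * card (perp U)"
      using less.prems(2) by (intro less.hyps[OF _ tiso_insert[OF less.prems(1) xi]])
    then show ?thesis using card_isoperp_step[OF sT xi] by (rule trans[rotated])
  qed simp
qed

end

section \<open>Counting totally isotropic subspaces through a given one\<close>

text \<open>\<open>type_count\<close> reads \<open>N * q^n = q^(2r + 1 + eps)\<close>. With
  \<open>N\<close> equal to \<open>q\<close>, \<open>sqrt q\<close> or 1 it ties dimension, rank and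
  type together in all six cases; \<open>powr\<close> admits a half-integral
  \<open>eps\<close>.\<close>

locale ranked_isotropy = isotropy scale Basis iso \<beta> N
  for scale :: "'a::{field,finite} \<Rightarrow> 'v::ab_group_add \<Rightarrow> 'v" and Basis :: "'v set" and iso \<beta> N +
  fixes r :: nat and Q :: polar_type
  assumes tiso_exists: "\<exists>M. tiso M \<and> dim M = r"
    and tiso_dim_le: "tiso M \<Longrightarrow> dim M \<le> r"
    and type_count: "real N * real CARD('a) ^ dim (UNIV :: 'v set) = real CARD('a) * real CARD('a) powr (2 * real r + polar_eps Q)"
begin

text \<open>An isotropic vector of \<open>perp M\<close> outside \<open>M\<close> would extend
  \<open>M\<close> beyond dimension \<open>r\<close>, so \<open>isoperp M = M\<close>.\<close>

lemma card_isoperp_max: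
  assumes "tiso M" "dim M = r"
  shows "card (isoperp M) = CARD('a) ^ r"
proof -
  have sM: "subspace M" using assms by (simp add: tiso_def)
  have "isoperp M \<subseteq> M"
  proof
    fix x assume x: "x \<in> isoperp M"
    show "x \<in> M"
    proof (rule ccontr)
      assume "x \<notin> M"
      then show False
        using tiso_dim_le[OF tiso_insert[OF assms(1) x]] dim_insert_new[OF sM, of x] assms(2) by simp
    qed
  qed
  then have "isoperp M = M" using tiso_subset_isoperp assms by blast
  then show ?thesis using card_subspace[OF sM] assms by simp
qed

text \<open>This counts the vectors that extend \<open>T\<close>. Up to \<open>q ^ dim T\<close>,
  the right side is the factor in \<open>polar_binomial_rec\<close> at
  \<open>m = r - dim T\<close>.\<close>

lemma card_isoperp:
  assumes T: "tiso T"
  shows "real (card (isoperp T)) - real CARD('a) ^ dim T =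
    real CARD('a) ^ dim T * ((real CARD('a) ^ (r - dim T) - 1) * (real CARD('a) powr (real (r - dim T) + polar_eps Q) + 1))"
proof -
  obtain M where M: "tiso M" "dim M = r" using tiso_exists by blast
  let ?n = "dim (UNIV :: 'v set)" and ?t = "dim T" and ?q = "real CARD('a)" and ?e = "polar_eps Q"
  define d where "d = r - ?t"
  have r: "r = ?t + d" using tiso_dim_le[OF T] by (simp add: d_def)
  have q0: "?q > 0" using q_gt_1 by linarith
  have zU: "{0} \<subseteq> U" if "tiso U" for U using that subspace_0 by (auto simp: tiso_def)
  have K: "real N * ?q ^ ?n = ?q * (?q ^ r * ?q ^ r * ?q powr ?e)"
    using type_count q0 by (simp add: powr_add powr_realpow mult_2 power_add flip: of_nat_add del: dim_UNIV)
  \<comment> \<open>Comparing both with \<open>{0}\<close> covers a \<open>T\<close> that does not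
    lie in \<open>M\<close>.\<close>
  have 1: "?q * card (isoperp T) - real N * card (perp T) = ?q * ?q ^ r - real N * card (perp M)"
    using card_isoperp_chain[OF tiso_zero T zU[OF T]] card_isoperp_chain[OF tiso_zero M(1) zU[OF M(1)]]
      card_isoperp_max[OF M] by simp
  have PM: "real (card (perp M)) * ?q ^ r = ?q ^ ?n"
    using card_perp[OF M(1)] M(2) by (metis of_nat_mult of_nat_power)
  have PT: "real (card (perp T)) * ?q ^ ?t = ?q ^ ?n"
    using card_perp[OF T] by (metis of_nat_mult of_nat_power)
  \<comment> \<open>Since \<open>perp M\<close> has \<open>q^(n - r)\<close> elements,
    \<open>type_count\<close> turns the product into \<open>q^(r + 1 + eps)\<close>.\<close>
  have NM: "real N * card (perp M) = ?q * (?q ^ r * ?q powr ?e)"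
  proof -
    have "(real N * card (perp M)) * ?q ^ r = (?q * (?q ^ r * ?q powr ?e)) * ?q ^ r"
      using K PM by (simp add: mult_ac del: dim_UNIV)
    then show ?thesis using q0 by simp
  qed
  have NT: "real N * card (perp T) = ?q * (?q ^ r * ?q ^ d * ?q powr ?e)"
  proof -
    have "(real N * card (perp T)) * ?q ^ ?t = (?q * (?q ^ r * ?q ^ d * ?q powr ?e)) * ?q ^ ?t"
      using K PT by (simp add: mult_ac r power_add del: dim_UNIV)
    then show ?thesis using q0 by simp
  qed
  have "?q * card (isoperp T) = ?q * (?q ^ r + ?q ^ r * ?q ^ d * ?q powr ?e - ?q ^ r * ?q powr ?e)"
    using 1 unfolding NM NT by (simp add: algebra_simps)
  then have "real (card (isoperp T)) = ?q ^ r + ?q ^ r * ?q ^ d * ?q powr ?e - ?q ^ r * ?q powr ?e"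
    using q0 by (simp only: mult_cancel_left) simp
  then show ?thesis
    unfolding d_def[symmetric] using q0
    by (simp add: r power_add powr_add powr_realpow algebra_simps)
qed

lemma card_tiso_above:
  assumes "tiso T" "dim T \<le> k" "k \<le> r"
  shows "real (card {K. tiso K \<and> dim K = k \<and> T \<subseteq> K}) =
    polar_binomial Q CARD('a) (int r - int (dim T)) (int k - int (dim T))"
  using assms
proof (induction "k - dim T" arbitrary: T)
  case 0
  \<comment> \<open>Here \<open>k = dim T\<close>, as \<open>dim T \<le> k\<close>, and a subspace
    of that dimension containing \<open>T\<close> is \<open>T\<close>.\<close>
  then have "{K. tiso K \<and> dim K = k \<and> T \<subseteq> K} = {T}"
    by (auto simp: tiso_def) (metis subsetD subspace_dim_equal order_refl)+
  then show ?case using 0 by (simp add: polar_binomial_0)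
next
  case (Suc m)
  let ?t = "dim T" and ?q = "real CARD('a)"
  let ?K = "{K. tiso K \<and> dim K = k \<and> T \<subseteq> K}" and ?S = "isoperp T - T"
  let ?pb = "polar_binomial Q CARD('a) (int r - int ?t - 1) (int k - int ?t - 1)"
    and ?X = "(?q powi (int r - int ?t) - 1) * (?q powr (real_of_int (int r - int ?t) + polar_eps Q) + 1)"
    and ?Y = "?q powi (int k - int ?t) - 1"
  have tk: "?t < k" using Suc.hyps by linarith
  have sT: "subspace T" using Suc.prems by (simp add: tiso_def)
  have cT: "card T = CARD('a) ^ ?t" using card_subspace sT by blast
  \<comment> \<open>A \<open>K\<close> through \<open>T\<close> and \<open>v\<close> is one through
    \<open>span (insert v T)\<close>, whose dimension is one closer to \<open>k\<close>.\<close>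
  have ext: "real (card {K \<in> ?K. v \<in> K}) = ?pb" if v: "v \<in> ?S" for v
  proof -
    let ?T = "span (insert v T)"
    have "{K \<in> ?K. v \<in> K} = {K. tiso K \<and> dim K = k \<and> ?T \<subseteq> K}"
      using span_minimal[of "insert v T"] span_superset[of "insert v T"] by (auto simp: tiso_def)
    moreover have d: "dim ?T = Suc ?t" using v sT dim_insert_new by blast
    moreover have "real (card {K. tiso K \<and> dim K = k \<and> ?T \<subseteq> K}) =
        polar_binomial Q CARD('a) (int r - int (dim ?T)) (int k - int (dim ?T))"
      using v Suc.prems Suc.hyps(2) tk d by (intro Suc.hyps(1) tiso_insert) auto
    ultimately show ?thesis by (simp add: algebra_simps)
  qed
  have cK: "card {v \<in> ?S. v \<in> K} = CARD('a) ^ k - CARD('a) ^ ?t" if K: "K \<in> ?K" for K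
  proof -
    have "{v \<in> ?S. v \<in> K} = K - T" using K tiso_subset_isoperp by blast
    moreover have "card K = CARD('a) ^ k" using card_subspace K by (auto simp: tiso_def)
    ultimately show ?thesis using K cT by (simp add: card_Diff_subset)
  qed
  have "(\<Sum>v\<in>?S. card {K \<in> ?K. v \<in> K}) = (CARD('a) ^ k - CARD('a) ^ ?t) * card ?K"
    by (intro sum_multicount) (use cK in auto)
  from arg_cong[OF this, of real]
  have "(\<Sum>v\<in>?S. real (card {K \<in> ?K. v \<in> K})) = real (CARD('a) ^ k - CARD('a) ^ ?t) * card ?K"
    by (simp only: of_nat_sum of_nat_mult)
  then have eq: "real (card ?S) * ?pb = real (CARD('a) ^ k - CARD('a) ^ ?t) * card ?K"
    using ext by simp
  have "T \<subseteq> isoperp T" using tiso_subset_isoperp Suc.prems by blast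
  then have "real (card ?S) = real (card (isoperp T)) - ?q ^ ?t"
    using cT card_mono[of "isoperp T" T] by (simp add: card_Diff_subset of_nat_diff)
  also have "\<dots> = ?q ^ ?t * ?X"
    using card_isoperp[OF Suc.prems(1)] Suc.prems tk
    by (simp add: power_int_def nat_diff_distrib of_nat_diff)
  finally have S: "real (card ?S) = \<dots>" .
  have "real (CARD('a) ^ k - CARD('a) ^ ?t) = ?q ^ ?t * ?Y"
  proof -
    have "CARD('a) ^ ?t \<le> CARD('a) ^ k" using tk q_gt_1 by (intro power_increasing) auto
    moreover have "?q ^ k = ?q ^ ?t * ?q ^ (k - ?t)" using tk by (simp flip: power_add)
    ultimately show ?thesis
      using tk by (simp add: of_nat_diff power_int_def nat_diff_distrib algebra_simps)
  qed
  with eq S have "?q ^ ?t * (?X * ?pb) = ?q ^ ?t * (?Y * card ?K)"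
    by (simp only: mult.assoc)
  moreover have nz: "?q ^ ?t \<noteq> 0" by simp
  ultimately have "?X * ?pb = ?Y * card ?K" by (simp only: mult_left_cancel[OF nz])
  \<comment> \<open>The recurrence has the same factors \<open>?X\<close> and \<open>?Y\<close> as
    the double count.\<close>
  moreover have "polar_binomial Q CARD('a) (int r - int ?t) (int k - int ?t) * ?Y = ?X * ?pb"
    using tk Suc.prems q_gt_1 by (intro polar_binomial_rec) auto
  ultimately have "?Y * card ?K = ?Y * polar_binomial Q CARD('a) (int r - int ?t) (int k - int ?t)"
    by (simp only: mult.commute)
  moreover have nz: "?Y \<noteq> 0"
  proof -
    have "?q ^ (k - ?t) > 1" using tk q_gt_1 by (intro one_less_power) auto
    then show ?thesis using tk by (simp add: power_int_def nat_diff_distrib)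
  qed
  ultimately show ?case by (simp only: mult_left_cancel[OF nz])
qed

end

section \<open>Alternating, quadratic and Hermitian forms\<close>

lemma linearD:
  assumes "Vector_Spaces.linear s1 s2 f"
  shows "f (x + y) = f x + f y" "f (s1 c x) = s2 c (f x)"
  using assms unfolding Vector_Spaces.linear_def module_hom_def module_hom_axioms_def by blast+

text \<open>Expanding \<open>B (x + y) (x + y) = 0\<close> gives skew symmetry, hence
  reflexivity.\<close>

lemma isotropy_alternating:
  fixes scale :: "'a::{field,finite} \<Rightarrow> 'v::ab_group_add \<Rightarrow> 'v"
  assumes V: "finite_dimensional_vector_space scale Basis"
    and alt: "alternating_form scale B" and nd: "nondegenerate B"
  shows "isotropy scale Basis (\<lambda>_. True) B CARD('a)"
proof -
  interpret finite_dimensional_vector_space scale Basis by fact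
  have lin: "Vector_Spaces.linear scale (*) (\<lambda>x. B x y)" "Vector_Spaces.linear scale (*) (\<lambda>y. B x y)" for x y
    using alt by (auto simp: alternating_form_def bilinear_form_def)
  have self: "B x x = 0" for x using alt by (simp add: alternating_form_def)
  have skew: "B x y + B y x = 0" for x y
  proof -
    have "0 = B (x + y) (x + y)" by (simp only: self)
    also have "\<dots> = B x y + B y x"
      by (simp only: linearD(1)[OF lin(1)] linearD(1)[OF lin(2)]) (simp add: self add.commute)
    finally show ?thesis by simp
  qed
  have refl: "B y x = 0" if "B x y = 0" for x y using skew[of x y] that by simp
  show ?thesis
  proof
    fix x assume "\<And>y. B y x = 0"
    then have "\<forall>y. B x y = 0" using refl by blast
    then show "x = 0" using nd by (simp add: nondegenerate_def)
  qed (use self refl in \<open>simp_all add: linearD[OF lin(1)]\<close>)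
qed

text \<open>For singular \<open>x\<close>, \<open>f\<close> is affine along \<open>v + c x\<close>
  with slope \<open>polarization f v x\<close>, so a nonzero slope gives exactly one zero.\<close>

lemma isotropy_quadratic:
  fixes scale :: "'a::{field,finite} \<Rightarrow> 'v::ab_group_add \<Rightarrow> 'v"
  assumes V: "finite_dimensional_vector_space scale Basis"
    and quad: "quadratic_form scale f" and ns: "nonsingular f"
  shows "isotropy scale Basis (\<lambda>x. f x = 0) (polarization f) 1"
proof -
  interpret finite_dimensional_vector_space scale Basis by fact
  have lin: "Vector_Spaces.linear scale (*) (\<lambda>x. polarization f x y)"
    "Vector_Spaces.linear scale (*) (\<lambda>y. polarization f x y)" for x y
    using quad by (auto simp: quadratic_form_def bilinear_form_def)
  have fs: "f (scale c x) = c\<^sup>2 * f x" for c x using quad by (simp add: quadratic_form_def)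
  have sym: "polarization f x y = polarization f y x" for x y
    by (simp add: polarization_def add.commute)
  have expand: "f (u + scale c v) = f u + c\<^sup>2 * f v + c * polarization f u v" for u v c
    using linearD(2)[OF lin(2), of u c v] by (simp add: polarization_def fs algebra_simps)
  show ?thesis
  proof
    show "f 0 = 0" using fs[of 0 0] by simp
  next
    fix x assume "f x = 0"
    moreover have "f (x + x) = f (scale (1 + 1) x)" by (simp only: scale_left_distrib scale_one)
    ultimately show "polarization f x x = 0" by (simp only: polarization_def fs) simp
  next
    fix x assume "f x = 0" "\<And>y. polarization f y x = 0"
    then show "x = 0" using ns sym by (simp add: nonsingular_def)
  next
    fix x v assume *: "f x = 0" "polarization f v x \<noteq> 0"
    then have "{c. f (v + scale c x) = 0} = {- f v / polarization f v x}"
      by (auto simp: expand field_simps eq_neg_iff_add_eq_0)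
    then show "card {c. f (v + scale c x) = 0} = 1" by simp
  next
    fix x y assume "polarization f x y = 0"
    then show "polarization f y x = 0" by (subst sym)
  qed (simp_all add: expand linearD[OF lin(1)])
qed

text \<open>For isotropic \<open>x\<close> and \<open>d = c * B x v\<close>, isotropy of
  \<open>v + c x\<close> is the trace equation \<open>d + d ^ s = - B v v\<close>.\<close>

lemma isotropy_hermitian:
  fixes scale :: "'a::{field,finite} \<Rightarrow> 'v::ab_group_add \<Rightarrow> 'v"
  assumes V: "finite_dimensional_vector_space scale Basis"
    and herm: "hermitian_form scale B" and nd: "nondegenerate B"
  obtains s where "CARD('a) = s\<^sup>2" "isotropy scale Basis (\<lambda>x. B x x = 0) B s"
proof -
  interpret finite_dimensional_vector_space scale Basis by fact
  obtain s where s: "CARD('a) = s\<^sup>2"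
    and lin: "\<And>y. Vector_Spaces.linear scale (*) (\<lambda>x. B x y)"
    and add2: "\<And>x y z. B x (y + z) = B x y + B x z"
    and scale2: "\<And>c x y. B x (scale c y) = c ^ s * B x y"
    and conj: "\<And>x y. B y x = (B x y) ^ s"
    using herm unfolding hermitian_form_def by blast
  have s0: "s > 0" using s by (cases s) auto
  have refl: "B y x = 0" if "B x y = 0" for x y using conj[of x y] that s0 by (simp add: zero_power)
  note expand = linearD[OF lin] add2 scale2
  have "isotropy scale Basis (\<lambda>x. B x x = 0) B s"
  proof
    show "B (x + y) z = B x z + B y z" "B (scale c x) z = c * B x z" for x y z c
      by (simp_all add: expand)
    show "B x y = 0 \<Longrightarrow> B y x = 0" for x y by (rule refl)
    show "B 0 0 = 0" using linearD(2)[OF lin, of 0 0 0] by simp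
    show "B x x = 0 \<Longrightarrow> B x x = 0" for x .
  next
    fix x assume "\<And>y. B y x = 0"
    then have "\<forall>y. B x y = 0" using refl by blast
    then show "x = 0" using nd by (simp add: nondegenerate_def)
  next
    fix u v c assume "B u u = 0" "B v v = 0" "B u v = 0"
    moreover from this have "B v u = 0" using refl by blast
    ultimately show "B (u + scale c v) (u + scale c v) = 0" by (simp add: expand)
  next
    fix x v assume x: "B x x = 0" and vx: "B v x \<noteq> 0"
    have xv: "B x v \<noteq> 0" using vx refl by blast
    \<comment> \<open>Additivity of the power \<open>s\<close> comes from the form:
      \<open>B v\<close> is additive and semilinear in its second argument, and \<open>B v x\<close>
      cancels.\<close>
    have padd: "(a + b) ^ s = a ^ s + b ^ s" for a b :: 'a
    proof -
      have "(a + b) ^ s * B v x = (a ^ s + b ^ s) * B v x"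
        using add2[of v "scale a x" "scale b x"]
        by (simp only: scale2 scale_left_distrib[symmetric] distrib_right)
      then show ?thesis using vx by simp
    qed
    \<comment> \<open>Some \<open>w\<close> has \<open>B w x = a\<close>; swapping the arguments
      twice applies the power \<open>s\<close> twice.\<close>
    have invol: "(a ^ s) ^ s = a" for a :: 'a
    proof -
      define w where "w = scale (a / B v x) v"
      have w: "B w x = a" using vx by (simp add: w_def expand)
      have "B w x = ((B w x) ^ s) ^ s" using conj[of x w] conj[of w x] by simp
      then show ?thesis by (simp add: w)
    qed
    have "B (v + scale c x) (v + scale c x) = 0 \<longleftrightarrow> c * B x v + (c * B x v) ^ s = - B v v" for c
    proof -
      have "c ^ s * B v x = (c * B x v) ^ s"
        by (subst conj[of v x]) (rule power_mult_distrib[symmetric])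
      then have "B (v + scale c x) (v + scale c x) = B v v + (c * B x v + (c * B x v) ^ s)"
        by (simp add: expand x algebra_simps)
      then show ?thesis by (simp only: eq_neg_iff_add_eq_0 add.commute[of "B v v"])
    qed
    then have "card {c. B (v + scale c x) (v + scale c x) = 0} =
        card {c. c * B x v + (c * B x v) ^ s = - B v v}" by (simp only:)
    also have "\<dots> = card {d. d + d ^ s = - B v v}" by (rule card_scale_preimage[OF xv])
    also have "\<dots> = s"
    proof (rule card_trace_fibre[OF s padd invol])
      \<comment> \<open>\<open>conj\<close> makes \<open>B v v\<close> fixed by the power
        \<open>s\<close>; additivity carries this to its negative.\<close>
      have "(- B v v) ^ s + B v v ^ s = 0"
        using padd[of "- B v v" "B v v"] s0 by (simp add: zero_power)
      then show "(- B v v) ^ s = - B v v" using conj[of v v] by (simp add: eq_neg_iff_add_eq_0)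
    qed
    finally show "card {c. B (v + scale c x) (v + scale c x) = 0} = s" .
  qed
  with s show ?thesis by (rule that)
qed

lemma classical_polar_space_isotropy:
  fixes scale :: "'a::{field,finite} \<Rightarrow> 'v::ab_group_add \<Rightarrow> 'v"
  assumes "classical_polar_space scale Basis F Q r"
  obtains iso \<beta> N where "isotropy scale Basis iso \<beta> N"
    "polar_space scale F = {U. isotropy.tiso scale iso \<beta> U}"
    "real N * real CARD('a) ^ vector_space.dim scale UNIV = real CARD('a) * real CARD('a) powr (2 * real r + polar_eps Q)"
proof -
  interpret classical_polar_space scale Basis F Q r by fact
  let ?q = "real CARD('a)"
  have q0: "?q > 0" by (simp add: card_gt_0_iff)
  have V: "finite_dimensional_vector_space scale Basis" by unfold_locales
  show ?thesis
  proof (cases F)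
    case (Alternating B)
    then have I: "isotropy scale Basis (\<lambda>_. True) B CARD('a)"
      using admissible by (intro isotropy_alternating V) auto
    have "?q powr (2 * r) = ?q ^ (2 * r)" using q0 powr_realpow[of ?q "2 * r"] by simp
    then show ?thesis using Alternating has_type
      by (intro that[OF I]) (auto simp: polar_space_def isotropy.tiso_def[OF I] simp del: dim_UNIV)
  next
    case (Quadratic f)
    then have I: "isotropy scale Basis (\<lambda>x. f x = 0) (polarization f) 1"
      using admissible by (intro isotropy_quadratic V) auto
    \<comment> \<open>If \<open>f\<close> vanishes on \<open>U\<close>, closure of \<open>U\<close>
      under addition makes the polarization vanish there too.\<close>
    have "polar_space scale F = {U. isotropy.tiso scale (\<lambda>x. f x = 0) (polarization f) U}"
      using Quadratic subspace_add
      by (auto simp: polar_space_def isotropy.tiso_def[OF I] polarization_def)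
    moreover have "?q ^ dim UNIV = ?q * ?q powr (2 * real r + polar_eps Q)"
    proof -
      have "?q * ?q powr (2 * real r + polar_eps Q) = ?q powr (1 + (2 * r + polar_eps Q))"
        using q0 by (simp add: powr_add)
      also have "1 + (2 * r + polar_eps Q) = real (dim UNIV)"
        using has_type Quadratic by (auto simp del: dim_UNIV)
      finally show ?thesis using q0 by (simp add: powr_realpow del: dim_UNIV)
    qed
    ultimately show ?thesis by (intro that[OF I]) (simp_all del: dim_UNIV)
  next
    case (Hermitian B)
    then obtain s where s: "CARD('a) = s\<^sup>2" and I: "isotropy scale Basis (\<lambda>x. B x x = 0) B s"
      using admissible isotropy_hermitian[OF V] by (metis admissible_form.simps(2))
    have "polar_space scale F = {U. isotropy.tiso scale (\<lambda>x. B x x = 0) B U}"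
      using Hermitian by (auto simp: polar_space_def isotropy.tiso_def[OF I])
    moreover have "real s * ?q ^ dim UNIV = ?q * ?q powr (2 * real r + polar_eps Q)"
    proof -
      have "s > 0" using s by (cases s) auto
      then have "real s = ?q powr (1 / 2)" using s by (simp add: powr_half_sqrt)
      then have "real s * ?q ^ dim UNIV = ?q powr (1 / 2 + real (dim UNIV))"
        using q0 by (simp add: powr_add powr_realpow del: dim_UNIV)
      also have "1 / 2 + real (dim UNIV) = 1 + (2 * r + polar_eps Q)"
        using has_type Hermitian by (auto simp del: dim_UNIV)
      also have "?q powr (1 + (2 * r + polar_eps Q)) = ?q * ?q powr (2 * real r + polar_eps Q)"
        using q0 by (simp add: powr_add)
      finally show ?thesis .
    qed
    ultimately show ?thesis by (intro that[OF I]) (simp_all del: dim_UNIV)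
  qed
qed

section \<open>Supplementary designs\<close>

theorem lemma4:
  fixes scale :: "'a::{field,finite} \<Rightarrow> 'v::ab_group_add \<Rightarrow> 'v"
    and Basis :: "'v set" and F :: "('a, 'v) polar_form" and Q :: polar_type
    and r t k :: nat and l :: real and D :: "'v set set"
  assumes "classical_polar_space scale Basis F Q r"
    and "r \<ge> 1"
    and "polar_design scale F t k l D"
  shows "polar_design scale F t k
           (polar_binomial Q CARD('a) (int r - int t) (int k - int t) - l)
           (supplementary_design scale F k D)"
proof -
  obtain iso \<beta> N where I: "isotropy scale Basis iso \<beta> N"
    and ps: "polar_space scale F = {U. isotropy.tiso scale iso \<beta> U}"
    and count: "real N * real CARD('a) ^ vector_space.dim scale UNIV =
      real CARD('a) * real CARD('a) powr (2 * real r + polar_eps Q)"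
    by (rule classical_polar_space_isotropy[OF assms(1)])
  interpret isotropy scale Basis iso \<beta> N by (rule I)
  have pr: "polar_rank scale F = r" using assms(1) by (rule classical_polar_space.rank)
  then have r: "r = Max (dim ` {U. tiso U})" by (simp add: polar_rank_def ps)
  interpret ranked_isotropy scale Basis iso \<beta> N r Q
  proof
    have "r \<in> dim ` {U. tiso U}" unfolding r using tiso_zero by (intro Max_in) auto
    then show "\<exists>M. tiso M \<and> dim M = r" by auto
    show "dim M \<le> r" if "tiso M" for M unfolding r using that by (intro Max_ge) auto
  qed (rule count)
  let ?m = "polar_binomial Q CARD('a) (int r - int t) (int k - int t)"
  have sub: "polar_subspaces scale F j = {U. tiso U \<and> dim U = j}" for j
    by (auto simp: polar_subspaces_def ps)
  have D: "t \<le> r" "k \<le> r" "D \<subseteq> {U. tiso U \<and> dim U = k}"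
    and l: "\<And>T. tiso T \<Longrightarrow> dim T = t \<Longrightarrow> real (card {B \<in> D. T \<subseteq> B}) = l"
    using assms(3) by (auto simp: polar_design_def pr sub)
  have all: "real (card {K. tiso K \<and> dim K = k \<and> T \<subseteq> K}) = ?m" if T: "tiso T" "dim T = t" for T
  proof (cases "t \<le> k")
    case True
    then show ?thesis using card_tiso_above[OF T(1), of k] T D by simp
  next
    \<comment> \<open>No subspace of dimension \<open>k < t\<close> contains \<open>T\<close>, and
      the negative lower argument makes \<open>?m\<close> zero.\<close>
    case False
    then have "{K. tiso K \<and> dim K = k \<and> T \<subseteq> K} = {}" using T dim_subset by fastforce
    then show ?thesis using False by (simp only: card.empty) (simp add: polar_binomial_def)
  qed
  have compl: "real (card {B \<in> supplementary_design scale F k D. T \<subseteq> B}) = ?m - l"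
    if T: "tiso T" "dim T = t" for T
  proof -
    let ?A = "{K. tiso K \<and> dim K = k \<and> T \<subseteq> K}" and ?B = "{B \<in> D. T \<subseteq> B}"
    have "{B \<in> supplementary_design scale F k D. T \<subseteq> B} = ?A - ?B"
      by (auto simp: supplementary_design_def sub)
    moreover have "?B \<subseteq> ?A" using D(3) by auto
    ultimately have "real (card {B \<in> supplementary_design scale F k D. T \<subseteq> B}) =
        real (card ?A) - real (card ?B)"
      by (simp add: card_Diff_subset of_nat_diff card_mono)
    then show ?thesis using all[OF T] l[OF T] by simp
  qed
  \<comment> \<open>Integrality of the new index needs an actual \<open>T\<close>, found inside a
    totally isotropic \<open>M\<close> of dimension \<open>r\<close>; the index is then a
    cardinality.\<close>
  obtain M where M: "tiso M" "dim M = r" using tiso_exists by blast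
  obtain T where T: "subspace T" "T \<subseteq> span M" "dim T = t"
    using choose_subspace_of_subspace[of t M] M D(1) by blast
  have "T \<subseteq> M" using T(2) M by (simp add: tiso_def span_eq_iff[THEN iffD2])
  then have "tiso T" using T(1) M(1) unfolding tiso_def by blast
  from compl[OF this T(3)] have "?m - l \<in> \<nat>" by (metis of_nat_in_Nats)
  then show ?thesis
    using D(1,2) compl by (auto simp: polar_design_def pr sub supplementary_design_def)
qed

end
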